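(* Let $\tau$ be a fixed finite unary vocabulary, and for each $n$ let $\mathbb{E}_n[C] := \frac{1}{2^{|\tau|n}}\sum_{\mathfrak{M}} C(\mathfrak{M})$, where the sum ranges over all $\tau$-models $\mathfrak{M}$ with domain $\{1,\dots,n\}$. Then $\mathbb{E}_n[C] \sim \frac{3n}{2^{|\tau|}}$ as $n\to\infty$.
   Context: A $\tau$-model of size $n$ has domain $\{1,\dots,n\}$ and interprets each unary symbol of $\tau$ as a subset (so there are $2^{|\tau|n}$ such models). $\mathrm{FO}[\tau]$-formulas are in negation normal form; size counts atomic formulas (negated or not), conjunctions, disjunctions and quantifiers, not negations. A sentence defines $\mathfrak{M}$ if among $\tau$-models of size $n$ exactly those isomorphic to $\mathfrak{M}$ satisfy it; $C(\mathfrak{M})$ is the minimum size of a defining $\mathrm{FO}[\tau]$-formula. $f(n)\sim g(n)$ means $f(n)/g(n)\to 1$.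
   Formalization: The vocabulary τ is assumed nonempty; for the empty vocabulary every model of size n ≥ 1 is defined by "for all x, x = x" of size 2, so the expected complexity is 2 and not asymptotic to 3n. *)

theory Defs
  imports Complex_Main "HOL-Library.FuncSet" "HOL-Library.Landau_Symbols"
begin

text \<open>
  First-order formulas with equality in negation normal form, over unary predicate symbols of type
  \<open>'p\<close> and the countable supply of variables \<open>nat\<close>. A literal carries a flag, which is \<open>False\<close>
  for a negated atom.
\<close>

datatype 'p fo =
    Eq bool nat nat
  | Pred bool 'p nat
  | And "'p fo" "'p fo"
  | Or "'p fo" "'p fo"
  | Ex nat "'p fo"
  | All nat "'p fo"

primrec fo_size :: "'p fo \<Rightarrow> nat" where
  "fo_size (Eq b x y) = 1"
| "fo_size (Pred b p x) = 1"
| "fo_size (And \<phi> \<psi>) = fo_size \<phi> + fo_size \<psi> + 1"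
| "fo_size (Or \<phi> \<psi>) = fo_size \<phi> + fo_size \<psi> + 1"
| "fo_size (Ex x \<phi>) = fo_size \<phi> + 1"
| "fo_size (All x \<phi>) = fo_size \<phi> + 1"

primrec symbols :: "'p fo \<Rightarrow> 'p set" where
  "symbols (Eq b x y) = {}"
| "symbols (Pred b p x) = {p}"
| "symbols (And \<phi> \<psi>) = symbols \<phi> \<union> symbols \<psi>"
| "symbols (Or \<phi> \<psi>) = symbols \<phi> \<union> symbols \<psi>"
| "symbols (Ex x \<phi>) = symbols \<phi>"
| "symbols (All x \<phi>) = symbols \<phi>"

primrec free_vars :: "'p fo \<Rightarrow> nat set" where
  "free_vars (Eq b x y) = {x, y}"
| "free_vars (Pred b p x) = {x}"
| "free_vars (And \<phi> \<psi>) = free_vars \<phi> \<union> free_vars \<psi>"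
| "free_vars (Or \<phi> \<psi>) = free_vars \<phi> \<union> free_vars \<psi>"
| "free_vars (Ex x \<phi>) = free_vars \<phi> - {x}"
| "free_vars (All x \<phi>) = free_vars \<phi> - {x}"

definition sentences :: "'p set \<Rightarrow> 'p fo set" where
  "sentences \<tau> = {\<phi>. symbols \<phi> \<subseteq> \<tau> \<and> free_vars \<phi> = {}}"

text \<open>
  A model of size \<open>n\<close> has domain \<open>{1..n}\<close> and is given by its interpretation of the symbols. Models
  are extensional outside \<open>\<tau>\<close>, so that there are exactly \<open>2 ^ (card \<tau> * n)\<close> of them for finite \<open>\<tau>\<close>.
\<close>

definition models :: "'p set \<Rightarrow> nat \<Rightarrow> ('p \<Rightarrow> nat set) set" where
  "models \<tau> n = (\<Pi>\<^sub>E p\<in>\<tau>. Pow {1..n})"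

primrec holds :: "nat \<Rightarrow> ('p \<Rightarrow> nat set) \<Rightarrow> (nat \<Rightarrow> nat) \<Rightarrow> 'p fo \<Rightarrow> bool" where
  "holds n M s (Eq b x y) = ((s x = s y) = b)"
| "holds n M s (Pred b p x) = ((s x \<in> M p) = b)"
| "holds n M s (And \<phi> \<psi>) = (holds n M s \<phi> \<and> holds n M s \<psi>)"
| "holds n M s (Or \<phi> \<psi>) = (holds n M s \<phi> \<or> holds n M s \<psi>)"
| "holds n M s (Ex x \<phi>) = (\<exists>a\<in>{1..n}. holds n M (s(x := a)) \<phi>)"
| "holds n M s (All x \<phi>) = (\<forall>a\<in>{1..n}. holds n M (s(x := a)) \<phi>)"

lemma holds_cong:
  assumes "\<And>x. x \<in> free_vars \<phi> \<Longrightarrow> s x = t x"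
  shows "holds n M s \<phi> = holds n M t \<phi>"
  using assms
proof (induction \<phi> arbitrary: s t)
  case (Ex x \<phi>)
  have "holds n M (s(x := a)) \<phi> = holds n M (t(x := a)) \<phi>" for a
    by (rule Ex.IH) (use Ex.prems in auto)
  then show ?case by simp
next
  case (All x \<phi>)
  have "holds n M (s(x := a)) \<phi> = holds n M (t(x := a)) \<phi>" for a
    by (rule All.IH) (use All.prems in auto)
  then show ?case by simp
next
  case (And \<phi> \<psi>)
  have "holds n M s \<phi> = holds n M t \<phi>" by (rule And.IH) (use And.prems in auto)
  moreover have "holds n M s \<psi> = holds n M t \<psi>" by (rule And.IH) (use And.prems in auto)
  ultimately show ?case by simp
next
  case (Or \<phi> \<psi>)
  have "holds n M s \<phi> = holds n M t \<phi>" by (rule Or.IH) (use Or.prems in auto)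
  moreover have "holds n M s \<psi> = holds n M t \<psi>" by (rule Or.IH) (use Or.prems in auto)
  ultimately show ?case by simp
qed auto

text \<open>For sentences the assignment is irrelevant, by \<open>holds_cong\<close>.\<close>

definition satisfies :: "nat \<Rightarrow> ('p \<Rightarrow> nat set) \<Rightarrow> 'p fo \<Rightarrow> bool" where
  "satisfies n M \<phi> \<longleftrightarrow> (\<forall>s. holds n M s \<phi>)"

definition isomorphic :: "'p set \<Rightarrow> nat \<Rightarrow> ('p \<Rightarrow> nat set) \<Rightarrow> ('p \<Rightarrow> nat set) \<Rightarrow> bool" where
  "isomorphic \<tau> n M N \<longleftrightarrow>
     (\<exists>f. bij_betw f {1..n} {1..n} \<and> (\<forall>p\<in>\<tau>. \<forall>a\<in>{1..n}. a \<in> M p \<longleftrightarrow> f a \<in> N p))"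

definition defines_model :: "'p set \<Rightarrow> nat \<Rightarrow> 'p fo \<Rightarrow> ('p \<Rightarrow> nat set) \<Rightarrow> bool" where
  "defines_model \<tau> n \<phi> M \<longleftrightarrow> (\<forall>N\<in>models \<tau> n. satisfies n N \<phi> \<longleftrightarrow> isomorphic \<tau> n M N)"

text \<open>
  Every model over a finite vocabulary is defined by some sentence (fix the number of elements
  realizing each type), so this minimum is over a nonempty set.
\<close>

definition description_complexity :: "'p set \<Rightarrow> nat \<Rightarrow> ('p \<Rightarrow> nat set) \<Rightarrow> nat" where
  "description_complexity \<tau> n M =
     (LEAST k. \<exists>\<phi>\<in>sentences \<tau>. defines_model \<tau> n \<phi> M \<and> fo_size \<phi> = k)"

definition expected_complexity :: "'p set \<Rightarrow> nat \<Rightarrow> real" where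
  "expected_complexity \<tau> n =
     1 / 2 ^ (card \<tau> * n) * (\<Sum>M\<in>models \<tau> n. real (description_complexity \<tau> n M))"

end

(*
  Write n_T for the number of elements realizing the type T, a set of unary symbols. For a random
  model every n_T is n / 2^|tau| up to an error of order sqrt n (second moment), so it suffices to
  show that the complexity is 3 n / 2^|tau| up to a constant factor times the total deviation.

  Upper bound: one block of k = max n_T existential quantifiers, shared by all types, bounds all n_T
  from above, hence determines them. Each witness costs a quantifier, an equality and a connective.

  Lower bound: moving a single element to another type gives a non-isomorphic model. Consider the
  graph whose vertices are the variables of a sentence and whose edges are its equality atoms. The
  sentence can compare two variables only within a component, so if all components have at most r
  variables and all n_T are at least r in both models, then the duplicator wins the
  Ehrenfeucht-Fraisse game on each component separately. A sentence that separates the two models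
  thus has a component with more than r variables, hence more than r quantifiers, at least r equality
  atoms and at least r - 1 connectives.
*)

theory Submission
  imports Defs "HOL-Combinatorics.Permutations" "HOL-Real_Asymp.Real_Asymp"
begin

section \<open>Element types and isomorphism of unary models\<close>

definition elem_type :: "'p set \<Rightarrow> ('p \<Rightarrow> nat set) \<Rightarrow> nat \<Rightarrow> 'p set" where
  "elem_type \<tau> M a = {p \<in> \<tau>. a \<in> M p}"

definition type_count :: "'p set \<Rightarrow> nat \<Rightarrow> ('p \<Rightarrow> nat set) \<Rightarrow> 'p set \<Rightarrow> nat" where
  "type_count \<tau> n M T = card {a \<in> {1..n}. elem_type \<tau> M a = T}"

lemma elem_type_in_Pow: "elem_type \<tau> M a \<in> Pow \<tau>"
  by (auto simp: elem_type_def)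

lemma elem_type_eq_iff: "elem_type \<tau> M a = elem_type \<tau> N b \<longleftrightarrow> (\<forall>p\<in>\<tau>. a \<in> M p \<longleftrightarrow> b \<in> N p)"
  by (auto simp: elem_type_def)

lemma sum_type_count:
  assumes "finite \<tau>"
  shows "(\<Sum>T\<in>Pow \<tau>. type_count \<tau> n M T) = n"
proof -
  have "(\<Sum>T\<in>Pow \<tau>. \<Sum>a | a \<in> {1..n} \<and> elem_type \<tau> M a = T. 1::nat) = (\<Sum>a\<in>{1..n}. 1)"
    by (rule sum.group) (use assms in \<open>auto simp: elem_type_def\<close>)
  then show ?thesis by (simp add: type_count_def)
qed

text \<open>In a unary model the type of an element is all there is to preserve. Equal counts mean
  that the multisets of realized types coincide, and two maps with the same image multiset differ by
  a permutation of the domain.\<close>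

lemma isomorphic_iff_type_count_eq:
  "isomorphic \<tau> n M N \<longleftrightarrow> (\<forall>T\<in>Pow \<tau>. type_count \<tau> n M T = type_count \<tau> n N T)"
proof
  assume "isomorphic \<tau> n M N"
  then obtain f where f: "bij_betw f {1..n} {1..n}"
    and eq: "\<And>a. a \<in> {1..n} \<Longrightarrow> elem_type \<tau> M a = elem_type \<tau> N (f a)"
    unfolding isomorphic_def elem_type_eq_iff by blast
  have "type_count \<tau> n M T = type_count \<tau> n N T" for T
    unfolding type_count_def
  proof (rule bij_betw_same_card)
    show "bij_betw f {a \<in> {1..n}. elem_type \<tau> M a = T} {a \<in> {1..n}. elem_type \<tau> N a = T}"
    proof (rule bij_betw_subset[OF f])
      show "f ` {a \<in> {1..n}. elem_type \<tau> M a = T} = {a \<in> {1..n}. elem_type \<tau> N a = T}"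
      proof (intro equalityI subsetI)
        fix b assume b: "b \<in> {a \<in> {1..n}. elem_type \<tau> N a = T}"
        then obtain a where "a \<in> {1..n}" "b = f a" using f by (metis (no_types, lifting) bij_betw_iff_bijections mem_Collect_eq)
        then show "b \<in> f ` {a \<in> {1..n}. elem_type \<tau> M a = T}" using b eq by blast
      qed (use f eq in \<open>auto simp: bij_betw_def\<close>)
    qed blast
  qed
  then show "\<forall>T\<in>Pow \<tau>. type_count \<tau> n M T = type_count \<tau> n N T" by blast
next
  assume eq: "\<forall>T\<in>Pow \<tau>. type_count \<tau> n M T = type_count \<tau> n N T"
  have count: "count (image_mset (elem_type \<tau> K) (mset_set {1..n})) T = type_count \<tau> n K T" for K T
  proof -
    have "elem_type \<tau> K -` {T} \<inter> {1..n} = {a \<in> {1..n}. elem_type \<tau> K a = T}" by blast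
    then show ?thesis by (simp add: count_image_mset type_count_def)
  qed
  \<comment> \<open>Multiset equality asks for every \<open>T\<close>; a set that is not contained
    in \<open>\<tau>\<close> is the type of no element, so both counts are 0.\<close>
  have "type_count \<tau> n M T = type_count \<tau> n N T" for T
  proof (cases "T \<in> Pow \<tau>")
    case False
    then have "{a \<in> {1..n}. elem_type \<tau> K a = T} = {}" for K
      by (auto simp: elem_type_def)
    then show ?thesis by (simp only: type_count_def)
  qed (use eq in blast)
  then have "image_mset (elem_type \<tau> M) (mset_set {1..n}) = image_mset (elem_type \<tau> N) (mset_set {1..n})"
    by (intro multiset_eqI) (simp only: count)
  then obtain f where f: "f permutes {1..n}" "\<forall>a\<in>{1..n}. elem_type \<tau> M a = elem_type \<tau> N (f a)"
    by (rule image_mset_eq_implies_permutes[OF finite_atLeastAtMost])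
  from f(2) have "\<forall>p\<in>\<tau>. \<forall>a\<in>{1..n}. a \<in> M p \<longleftrightarrow> f a \<in> N p" by (auto simp: elem_type_eq_iff)
  with permutes_imp_bij[OF f(1)] show "isomorphic \<tau> n M N"
    unfolding isomorphic_def by blast
qed

section \<open>Lower bound\<close>

primrec bound_vars :: "'p fo \<Rightarrow> nat set" where
  "bound_vars (Eq b x y) = {}"
| "bound_vars (Pred b p x) = {}"
| "bound_vars (And \<phi> \<psi>) = bound_vars \<phi> \<union> bound_vars \<psi>"
| "bound_vars (Or \<phi> \<psi>) = bound_vars \<phi> \<union> bound_vars \<psi>"
| "bound_vars (Ex x \<phi>) = insert x (bound_vars \<phi>)"
| "bound_vars (All x \<phi>) = insert x (bound_vars \<phi>)"

text \<open>The edge set of the graph on variables. Repeated atoms and the two polarities give the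
  same edge, so its cardinality only bounds the number of equality atoms from below, just as
  \<open>bound_vars\<close> does for quantifiers.\<close>

primrec eq_pairs :: "'p fo \<Rightarrow> (nat \<times> nat) set" where
  "eq_pairs (Eq b x y) = {(x, y)}"
| "eq_pairs (Pred b p x) = {}"
| "eq_pairs (And \<phi> \<psi>) = eq_pairs \<phi> \<union> eq_pairs \<psi>"
| "eq_pairs (Or \<phi> \<psi>) = eq_pairs \<phi> \<union> eq_pairs \<psi>"
| "eq_pairs (Ex x \<phi>) = eq_pairs \<phi>"
| "eq_pairs (All x \<phi>) = eq_pairs \<phi>"

lemma finite_bound_vars: "finite (bound_vars \<phi>)" and finite_eq_pairs: "finite (eq_pairs \<phi>)"
  by (induction \<phi>) auto

text \<open>A formula has one more literal than it has binary connectives. Hence its size plus 1 is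
  the number of quantifiers plus twice the number of literals.\<close>

lemma card_bound_vars_eq_pairs: "card (bound_vars \<phi>) + 2 * card (eq_pairs \<phi>) \<le> fo_size \<phi> + 1"
proof (induction \<phi>)
  case (And \<phi> \<psi>)
  then show ?case
    using card_Un_le[of "bound_vars \<phi>" "bound_vars \<psi>"] card_Un_le[of "eq_pairs \<phi>" "eq_pairs \<psi>"] by simp
next
  case (Or \<phi> \<psi>)
  then show ?case
    using card_Un_le[of "bound_vars \<phi>" "bound_vars \<psi>"] card_Un_le[of "eq_pairs \<phi>" "eq_pairs \<psi>"] by simp
qed (auto simp: card_insert_if finite_bound_vars)

text \<open>The map \<open>c\<close> labels components. Each edge merges at most two classes, so at
  least \<open>card V - card E\<close> labels remain on \<open>V\<close>. A class of size m leaves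
  only \<open>card V - m\<close> vertices to carry the other labels, whence m is at most
  \<open>card E + 1\<close>.\<close>

lemma small_components:
  fixes V :: "'v set"
  assumes "finite V" "finite E"
  shows "\<exists>c :: 'v \<Rightarrow> 'v. (\<forall>(x, y)\<in>E. c x = c y) \<and> (\<forall>v. card {x \<in> V. c x = v} \<le> card E + 1)"
proof -
  have "\<exists>c :: 'v \<Rightarrow> 'v. (\<forall>(x, y)\<in>E. c x = c y) \<and> card V \<le> card E + card (c ` V)"
    using \<open>finite E\<close>
  proof (induction E)
    case empty
    show ?case by (intro exI[of _ id]) auto
  next
    case (insert e E)
    then obtain c :: "'v \<Rightarrow> 'v" where c: "\<forall>(x, y)\<in>E. c x = c y" "card V \<le> card E + card (c ` V)"
      by blast
    obtain u v where e: "e = (u, v)" by force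
    \<comment> \<open>The class of \<open>v\<close> is absorbed by that of \<open>u\<close>; the
      only label that can disappear is \<open>c v\<close>.\<close>
    define c' where "c' = (\<lambda>y. if c y = c v then c u else c y)"
    have "c ` V \<subseteq> insert (c v) (c' ` V)" by (auto simp: c'_def)
    then have "card (c ` V) \<le> card (insert (c v) (c' ` V))"
      using assms(1) by (intro card_mono) auto
    also have "\<dots> \<le> Suc (card (c' ` V))" by (simp add: card_insert_le_m1 card_insert_if assms(1))
    finally have "card V \<le> card (insert e E) + card (c' ` V)" using c(2) insert by simp
    moreover have "\<forall>(x, y)\<in>insert e E. c' x = c' y" using c(1) by (auto simp: c'_def e)
    ultimately show ?case by blast
  qed
  then obtain c :: "'v \<Rightarrow> 'v" where c: "\<forall>(x, y)\<in>E. c x = c y" "card V \<le> card E + card (c ` V)"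
    by blast
  have "card {x \<in> V. c x = v} \<le> card E + 1" for v
  proof -
    \<comment> \<open>The whole class of \<open>v\<close> contributes one label, every other vertex
      at most one.\<close>
    have "c ` V \<subseteq> insert v (c ` {x \<in> V. c x \<noteq> v})" by auto
    then have "card (c ` V) \<le> card (insert v (c ` {x \<in> V. c x \<noteq> v}))"
      using assms(1) by (intro card_mono) auto
    also have "\<dots> \<le> Suc (card (c ` {x \<in> V. c x \<noteq> v}))" by (simp add: card_insert_if assms(1))
    also have "\<dots> \<le> Suc (card {x \<in> V. c x \<noteq> v})" by (simp add: card_image_le assms(1))
    finally have "card (c ` V) \<le> Suc (card {x \<in> V. c x \<noteq> v})" .
    moreover have "card V = card {x \<in> V. c x = v} + card {x \<in> V. c x \<noteq> v}"
      by (rule card_Int_Diff[OF assms(1), of "{x. c x = v}", THEN trans])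
        (auto intro!: arg_cong2[of _ _ _ _ "(+)"] arg_cong[of _ _ card])
    ultimately show ?thesis using c(2) by simp
  qed
  with c(1) show ?thesis by blast
qed

section \<open>The Ehrenfeucht-Fraisse game played on components\<close>

text \<open>A winning position for the duplicator: a partial isomorphism, except that equalities are
  compared only within a class of \<open>c\<close>. Across classes no equality atom can observe
  them.\<close>

definition locally_similar ::
    "'p set \<Rightarrow> (nat \<Rightarrow> nat) \<Rightarrow> nat set \<Rightarrow> ('p \<Rightarrow> nat set) \<Rightarrow> (nat \<Rightarrow> nat) \<Rightarrow>
     ('p \<Rightarrow> nat set) \<Rightarrow> (nat \<Rightarrow> nat) \<Rightarrow> bool" where
  "locally_similar \<tau> c X M s N t \<longleftrightarrow>
     (\<forall>x\<in>X. elem_type \<tau> M (s x) = elem_type \<tau> N (t x)) \<and>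
     (\<forall>x\<in>X. \<forall>y\<in>X. c x = c y \<longrightarrow> (s x = s y \<longleftrightarrow> t x = t y))"

lemma locally_similar_sym: "locally_similar \<tau> c X M s N t \<Longrightarrow> locally_similar \<tau> c X N t M s"
  by (auto simp: locally_similar_def)

lemma locally_similar_mono:
  "locally_similar \<tau> c X M s N t \<Longrightarrow> Y \<subseteq> X \<Longrightarrow> locally_similar \<tau> c Y M s N t"
  unfolding locally_similar_def by blast

text \<open>The duplicator's answer to the move \<open>a\<close>. If \<open>a\<close> is already the
  value of a variable in the class of \<open>x\<close>, its partner is the answer. Otherwise an
  element of the type of \<open>a\<close> is needed that avoids the values of the other variables in
  that class. The old value of \<open>x\<close> is overwritten, hence
  \<open>X - {x}\<close>.\<close>

lemma locally_similar_extend: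
  assumes sim: "locally_similar \<tau> c (X - {x}) M s N t"
    and V: "finite V" "insert x X \<subseteq> V" "\<And>v. card {y \<in> V. c y = v} \<le> r"
    and N: "\<And>T. T \<in> Pow \<tau> \<Longrightarrow> r \<le> type_count \<tau> n N T"
    and range: "t ` (X - {x}) \<subseteq> {1..n}"
  shows "\<exists>b\<in>{1..n}. locally_similar \<tau> c X M (s(x := a)) N (t(x := b))"
proof (cases "\<exists>y\<in>X - {x}. c y = c x \<and> s y = a")
  case True
  then obtain y where y: "y \<in> X - {x}" "c y = c x" "s y = a" by blast
  have "locally_similar \<tau> c X M (s(x := a)) N (t(x := t y))"
    using sim y unfolding locally_similar_def by (auto simp: fun_upd_def)
  then show ?thesis using range y(1) by blast
next
  case False
  define Y where "Y = {y \<in> X - {x}. c y = c x}"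
  define B where "B = {b \<in> {1..n}. elem_type \<tau> N b = elem_type \<tau> M a}"
  \<comment> \<open>The inclusion is strict because \<open>x\<close> itself lies in its class. So at
    most \<open>r - 1\<close> values are forbidden, and \<open>r\<close> elements of the type are
    enough.\<close>
  have "Y \<subset> {y \<in> V. c y = c x}" unfolding Y_def using V(2) by auto
  then have "card Y < card {y \<in> V. c y = c x}" using V(1) by (intro psubset_card_mono) auto
  moreover have fin: "finite Y" using V(1,2) by (auto simp: Y_def intro: rev_finite_subset)
  ultimately have "card (t ` Y) < r" using V(3)[of "c x"] card_image_le[OF fin, of t] by simp
  also have "r \<le> card B" using N[OF elem_type_in_Pow[of \<tau> M a]] by (simp add: type_count_def B_def)
  finally have "\<not> B \<subseteq> t ` Y" using card_mono[of "t ` Y" B] fin by auto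
  then obtain b where b: "b \<in> B" "b \<notin> t ` Y" by blast
  have "locally_similar \<tau> c X M (s(x := a)) N (t(x := b))"
    using sim b False unfolding locally_similar_def B_def Y_def by (auto simp: fun_upd_def)
  then show ?thesis using b by (auto simp: B_def)
qed

text \<open>Induction along the game: literals cannot leave a class of \<open>c\<close>, and each
  quantifier is answered by \<open>locally_similar_extend\<close>. The assignments must stay in the
  domain on free variables because an answer may reuse one of their values.\<close>

lemma holds_transfer:
  assumes "finite V" "\<And>v. card {y \<in> V. c y = v} \<le> r"
    and "\<And>T. T \<in> Pow \<tau> \<Longrightarrow> r \<le> type_count \<tau> n M T"
    and "\<And>T. T \<in> Pow \<tau> \<Longrightarrow> r \<le> type_count \<tau> n N T"
    and "symbols \<phi> \<subseteq> \<tau>" "free_vars \<phi> \<union> bound_vars \<phi> \<subseteq> V"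
    and "\<And>x y. (x, y) \<in> eq_pairs \<phi> \<Longrightarrow> c x = c y"
    and "s ` free_vars \<phi> \<subseteq> {1..n}" "t ` free_vars \<phi> \<subseteq> {1..n}"
    and "locally_similar \<tau> c (free_vars \<phi>) M s N t"
  shows "holds n M s \<phi> \<longleftrightarrow> holds n N t \<phi>"
  using assms(5-)
proof (induction \<phi> arbitrary: s t)
  case (Eq b x y)
  then show ?case by (simp add: locally_similar_def)
next
  case (Pred b p x)
  then show ?case by (auto simp: locally_similar_def elem_type_eq_iff)
next
  case (And \<phi> \<psi>)
  have "holds n M s \<phi> = holds n N t \<phi>"
    by (rule And.IH(1)) (use And.prems in \<open>auto intro: locally_similar_mono\<close>)
  moreover have "holds n M s \<psi> = holds n N t \<psi>"
    by (rule And.IH(2)) (use And.prems in \<open>auto intro: locally_similar_mono\<close>)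
  ultimately show ?case by simp
next
  case (Or \<phi> \<psi>)
  have "holds n M s \<phi> = holds n N t \<phi>"
    by (rule Or.IH(1)) (use Or.prems in \<open>auto intro: locally_similar_mono\<close>)
  moreover have "holds n M s \<psi> = holds n N t \<psi>"
    by (rule Or.IH(2)) (use Or.prems in \<open>auto intro: locally_similar_mono\<close>)
  ultimately show ?case by simp
next
  case (Ex x \<phi>)
  note prems = Ex.prems[simplified]
  have V: "insert x (free_vars \<phi>) \<subseteq> V" using prems by auto
  have step: "holds n M (s(x := a)) \<phi> = holds n N (t(x := b)) \<phi>"
    if "a \<in> {1..n}" "b \<in> {1..n}" "locally_similar \<tau> c (free_vars \<phi>) M (s(x := a)) N (t(x := b))" for a b
    by (rule Ex.IH[OF _ _ _ _ _ that(3)]) (use prems that(1,2) in auto)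
  have "\<exists>b\<in>{1..n}. locally_similar \<tau> c (free_vars \<phi>) M (s(x := a)) N (t(x := b))" for a
    by (rule locally_similar_extend[OF _ assms(1) V assms(2,4)]) (use prems in auto)
  \<comment> \<open>Here the spoiler moves in \<open>N\<close>; by symmetry the answer is found in
    \<open>M\<close>, which uses the lower bound on the counts of \<open>M\<close>.\<close>
  moreover have "\<exists>b\<in>{1..n}. locally_similar \<tau> c (free_vars \<phi>) N (t(x := a)) M (s(x := b))" for a
    by (rule locally_similar_extend[OF locally_similar_sym assms(1) V assms(2,3)]) (use prems in auto)
  then have "\<exists>b\<in>{1..n}. locally_similar \<tau> c (free_vars \<phi>) M (s(x := b)) N (t(x := a))" for a
    using locally_similar_sym by blast
  ultimately show ?case
    unfolding holds.simps using step by blast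
next
  case (All x \<phi>)
  note prems = All.prems[simplified]
  have V: "insert x (free_vars \<phi>) \<subseteq> V" using prems by auto
  have step: "holds n M (s(x := a)) \<phi> = holds n N (t(x := b)) \<phi>"
    if "a \<in> {1..n}" "b \<in> {1..n}" "locally_similar \<tau> c (free_vars \<phi>) M (s(x := a)) N (t(x := b))" for a b
    by (rule All.IH[OF _ _ _ _ _ that(3)]) (use prems that(1,2) in auto)
  have "\<exists>b\<in>{1..n}. locally_similar \<tau> c (free_vars \<phi>) M (s(x := a)) N (t(x := b))" for a
    by (rule locally_similar_extend[OF _ assms(1) V assms(2,4)]) (use prems in auto)
  moreover have "\<exists>b\<in>{1..n}. locally_similar \<tau> c (free_vars \<phi>) N (t(x := a)) M (s(x := b))" for a
    by (rule locally_similar_extend[OF locally_similar_sym assms(1) V assms(2,3)]) (use prems in auto)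
  then have "\<exists>b\<in>{1..n}. locally_similar \<tau> c (free_vars \<phi>) M (s(x := b)) N (t(x := a))" for a
    using locally_similar_sym by blast
  ultimately show ?case
    unfolding holds.simps using step by blast
qed

text \<open>For a sentence the initial position is empty, so the game is lost only if some class has
  at least \<open>r + 1\<close> bound variables. Then there are at least \<open>r\<close> equality
  pairs, and the size is at least \<open>(r + 1) + 2 * r - 1\<close>.\<close>

lemma fo_size_ge_if_distinguishes:
  assumes "\<phi> \<in> sentences \<tau>"
    and "\<And>T. T \<in> Pow \<tau> \<Longrightarrow> r \<le> type_count \<tau> n M T"
    and "\<And>T. T \<in> Pow \<tau> \<Longrightarrow> r \<le> type_count \<tau> n N T"
    and "satisfies n M \<phi>" "\<not> satisfies n N \<phi>"
  shows "3 * r \<le> fo_size \<phi>"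
proof -
  from assms(5) obtain t where t: "\<not> holds n N t \<phi>" by (auto simp: satisfies_def)
  have M: "holds n M t \<phi>" using assms(4) by (simp add: satisfies_def)
  have \<phi>: "symbols \<phi> \<subseteq> \<tau>" "free_vars \<phi> = {}" using assms(1) by (auto simp: sentences_def)
  obtain c :: "nat \<Rightarrow> nat" where eq: "\<forall>(x, y)\<in>eq_pairs \<phi>. c x = c y"
    and c: "\<forall>v. card {x \<in> bound_vars \<phi>. c x = v} \<le> card (eq_pairs \<phi>) + 1"
    using small_components[OF finite_bound_vars[of \<phi>] finite_eq_pairs[of \<phi>]] by blast
  have "\<not> (\<forall>v. card {x \<in> bound_vars \<phi>. c x = v} \<le> r)"
  proof
    assume "\<forall>v. card {x \<in> bound_vars \<phi>. c x = v} \<le> r"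
    then have "holds n M t \<phi> \<longleftrightarrow> holds n N t \<phi>"
      by (intro holds_transfer[where c = c, OF finite_bound_vars _ assms(2,3) \<phi>(1)])
        (use eq in \<open>auto simp: \<phi>(2) locally_similar_def\<close>)
    then show False using M t by simp
  qed
  then obtain v where v: "r < card {x \<in> bound_vars \<phi>. c x = v}" by (meson not_le)
  also have "\<dots> \<le> card (bound_vars \<phi>)" by (intro card_mono) (auto simp: finite_bound_vars)
  finally show ?thesis using v c[rule_format, of v] card_bound_vars_eq_pairs[of \<phi>] by simp
qed

text \<open>One element of the full type \<open>\<tau>\<close> is removed from a single predicate
  \<open>p\<close>. The cardinality of \<open>p\<close> drops, which rules out an isomorphism, while
  each type loses at most this one element.\<close>

lemma exists_near_nonisomorphic:
  assumes "finite \<tau>" "\<tau> \<noteq> {}" "M \<in> models \<tau> n"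
    and "\<And>T. T \<in> Pow \<tau> \<Longrightarrow> Suc r \<le> type_count \<tau> n M T"
  obtains N where "N \<in> models \<tau> n" "\<not> isomorphic \<tau> n M N"
    "\<And>T. T \<in> Pow \<tau> \<Longrightarrow> r \<le> type_count \<tau> n N T"
proof -
  from assms(2) obtain p where p: "p \<in> \<tau>" by blast
  have "0 < type_count \<tau> n M \<tau>" using assms(4)[of \<tau>] by simp
  then obtain a where a: "a \<in> {1..n}" "elem_type \<tau> M a = \<tau>"
    by (auto simp: type_count_def card_gt_0_iff)
  then have aM: "a \<in> M p" using p by (auto simp: elem_type_def)
  define N where "N = M(p := M p - {a})"
  have Mp: "M p \<subseteq> {1..n}" using assms(3) p by (auto simp: models_def PiE_def Pi_def)
  have "N \<in> models \<tau> n"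
    using assms(3) p Mp unfolding models_def N_def by (auto simp: PiE_def Pi_def extensional_def)
  moreover have "\<not> isomorphic \<tau> n M N"
  proof
    assume "isomorphic \<tau> n M N"
    then obtain f where f: "bij_betw f {1..n} {1..n}" "\<And>a. a \<in> {1..n} \<Longrightarrow> a \<in> M p \<longleftrightarrow> f a \<in> N p"
      using p unfolding isomorphic_def by blast
    \<comment> \<open>An isomorphism would embed \<open>M p\<close> into the strictly smaller finite
      set \<open>N p\<close>.\<close>
    have "inj_on f (M p)" using f(1) Mp by (auto simp: bij_betw_def intro: inj_on_subset)
    then have "card (M p) \<le> card (N p)"
      using f(2) Mp by (intro card_inj_on_le[of f]) (auto simp: N_def intro: finite_subset)
    moreover have "card (N p) < card (M p)"
      unfolding N_def fun_upd_same by (rule card_Diff1_less) (use aM Mp in \<open>auto intro: finite_subset\<close>)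
    ultimately show False by simp
  qed
  moreover have "r \<le> type_count \<tau> n N T" if "T \<in> Pow \<tau>" for T
  proof -
    have "{b \<in> {1..n}. elem_type \<tau> M b = T} \<subseteq> insert a {b \<in> {1..n}. elem_type \<tau> N b = T}"
      by (auto simp: elem_type_def N_def)
    then have "type_count \<tau> n M T \<le> card (insert a {b \<in> {1..n}. elem_type \<tau> N b = T})"
      unfolding type_count_def by (intro card_mono) auto
    also have "\<dots> \<le> Suc (type_count \<tau> n N T)" by (simp add: card_insert_if type_count_def)
    finally show ?thesis using assms(4)[OF that] by simp
  qed
  ultimately show ?thesis by (rule that)
qed

lemma isomorphic_refl: "isomorphic \<tau> n M M"
  by (simp add: isomorphic_iff_type_count_eq)

lemma fo_size_ge_if_defines:
  assumes "finite \<tau>" "\<tau> \<noteq> {}" "M \<in> models \<tau> n"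
    and "\<And>T. T \<in> Pow \<tau> \<Longrightarrow> Suc r \<le> type_count \<tau> n M T"
    and "\<phi> \<in> sentences \<tau>" "defines_model \<tau> n \<phi> M"
  shows "3 * r \<le> fo_size \<phi>"
proof -
  obtain N where N: "N \<in> models \<tau> n" "\<not> isomorphic \<tau> n M N"
    "\<And>T. T \<in> Pow \<tau> \<Longrightarrow> r \<le> type_count \<tau> n N T"
    using exists_near_nonisomorphic[OF assms(1-4)] by blast
  show ?thesis
  proof (rule fo_size_ge_if_distinguishes[OF assms(5) _ N(3)])
    show "r \<le> type_count \<tau> n M T" if "T \<in> Pow \<tau>" for T using assms(4)[OF that] by simp
    show "satisfies n M \<phi>" "\<not> satisfies n N \<phi>"
      using assms(3,6) N(1,2) isomorphic_refl unfolding defines_model_def by auto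
  qed
qed

section \<open>Upper bound\<close>

text \<open>The syntax has no truth constants, so the fold ends in an explicit last member
  \<open>\<chi>\<close>; this also makes the empty list meaningful.\<close>

definition big_or :: "('a \<Rightarrow> 'p fo) \<Rightarrow> 'p fo \<Rightarrow> 'a list \<Rightarrow> 'p fo" where
  "big_or F \<chi> xs = foldr (\<lambda>x. Or (F x)) xs \<chi>"

definition big_and :: "('a \<Rightarrow> 'p fo) \<Rightarrow> 'p fo \<Rightarrow> 'a list \<Rightarrow> 'p fo" where
  "big_and F \<chi> xs = foldr (\<lambda>x. And (F x)) xs \<chi>"

lemma big_or_simps:
  "holds n M s (big_or F \<chi> xs) \<longleftrightarrow> (\<exists>x\<in>set xs. holds n M s (F x)) \<or> holds n M s \<chi>"
  "symbols (big_or F \<chi> xs) = (\<Union>x\<in>set xs. symbols (F x)) \<union> symbols \<chi>"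
  "free_vars (big_or F \<chi> xs) = (\<Union>x\<in>set xs. free_vars (F x)) \<union> free_vars \<chi>"
  "fo_size (big_or F \<chi> xs) = (\<Sum>x\<leftarrow>xs. fo_size (F x) + 1) + fo_size \<chi>"
  unfolding big_or_def by (induction xs) auto

lemma big_and_simps:
  "holds n M s (big_and F \<chi> xs) \<longleftrightarrow> (\<forall>x\<in>set xs. holds n M s (F x)) \<and> holds n M s \<chi>"
  "symbols (big_and F \<chi> xs) = (\<Union>x\<in>set xs. symbols (F x)) \<union> symbols \<chi>"
  "free_vars (big_and F \<chi> xs) = (\<Union>x\<in>set xs. free_vars (F x)) \<union> free_vars \<chi>"
  "fo_size (big_and F \<chi> xs) = (\<Sum>x\<leftarrow>xs. fo_size (F x) + 1) + fo_size \<chi>"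
  unfolding big_and_def by (induction xs) auto

lemma foldr_Ex_simps:
  "symbols (foldr Ex xs \<phi>) = symbols \<phi>"
  "free_vars (foldr Ex xs \<phi>) = free_vars \<phi> - set xs"
  "fo_size (foldr Ex xs \<phi>) = length xs + fo_size \<phi>"
  by (induction xs) auto

text \<open>A quantifier block amounts to one simultaneous choice \<open>f\<close> of values for its
  variables.\<close>

lemma holds_foldr_Ex:
  "holds n M s (foldr Ex xs \<phi>) \<longleftrightarrow>
    (\<exists>f. f ` set xs \<subseteq> {1..n} \<and> holds n M (override_on s f (set xs)) \<phi>)"
proof (induction xs arbitrary: s)
  case (Cons x xs)
  show ?case
  proof
    assume "holds n M s (foldr Ex (x # xs) \<phi>)"
    then obtain a where a: "a \<in> {1..n}" and "holds n M (s(x := a)) (foldr Ex xs \<phi>)"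
      unfolding foldr.simps o_apply holds.simps by blast
    then obtain f where f: "f ` set xs \<subseteq> {1..n}" "holds n M (override_on (s(x := a)) f (set xs)) \<phi>"
      unfolding Cons.IH by blast
    \<comment> \<open>If \<open>x\<close> occurs again in \<open>xs\<close>, the inner quantifier
      overrides the outer choice \<open>a\<close>.\<close>
    define g where "g = (if x \<in> set xs then f else f(x := a))"
    have "g ` set (x # xs) \<subseteq> {1..n}" using a f(1) by (auto simp: g_def)
    moreover have "override_on s g (set (x # xs)) = override_on (s(x := a)) f (set xs)"
      by (auto simp: g_def override_on_def fun_eq_iff)
    ultimately show "\<exists>f. f ` set (x # xs) \<subseteq> {1..n} \<and> holds n M (override_on s f (set (x # xs))) \<phi>"
      using f(2) by (intro exI[of _ g]) (simp only:)
  next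
    assume "\<exists>f. f ` set (x # xs) \<subseteq> {1..n} \<and> holds n M (override_on s f (set (x # xs))) \<phi>"
    then obtain f where f: "f ` set (x # xs) \<subseteq> {1..n}" "holds n M (override_on s f (set (x # xs))) \<phi>"
      by blast
    have "override_on s f (set (x # xs)) = override_on (s(x := f x)) f (set xs)"
      by (auto simp: override_on_def fun_eq_iff)
    then have "holds n M (s(x := f x)) (foldr Ex xs \<phi>)" unfolding Cons.IH using f by auto
    moreover have "f x \<in> {1..n}" using f(1) by auto
    ultimately show "holds n M s (foldr Ex (x # xs) \<phi>)" by auto
  qed
qed simp

text \<open>The literal \<open>Eq False x x\<close> serves as falsity. The size depends on the
  vocabulary only.\<close>

definition differ_fo :: "'p list \<Rightarrow> nat \<Rightarrow> nat \<Rightarrow> 'p fo" where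
  "differ_fo ps x y =
     big_or (\<lambda>p. Or (And (Pred True p x) (Pred False p y)) (And (Pred False p x) (Pred True p y)))
       (Eq False x x) ps"

text \<open>For each symbol \<open>p\<close> the flag \<open>p \<notin> T\<close> selects the
  literal that contradicts membership as prescribed by \<open>T\<close>.\<close>

definition not_type_fo :: "'p list \<Rightarrow> 'p set \<Rightarrow> nat \<Rightarrow> 'p fo" where
  "not_type_fo ps T x = big_or (\<lambda>p. Pred (p \<notin> T) p x) (Eq False x x) ps"

lemma differ_fo_simps:
  "holds n M s (differ_fo ps x y) \<longleftrightarrow> elem_type (set ps) M (s x) \<noteq> elem_type (set ps) M (s y)"
  "symbols (differ_fo ps x y) = set ps"
  "free_vars (differ_fo ps x y) \<subseteq> {x, y}"
  "fo_size (differ_fo ps x y) = 8 * length ps + 1"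
  by (auto simp: differ_fo_def big_or_simps elem_type_eq_iff sum_list_triv)

lemma not_type_fo_simps:
  "T \<subseteq> set ps \<Longrightarrow> holds n M s (not_type_fo ps T x) \<longleftrightarrow> elem_type (set ps) M (s x) \<noteq> T"
  "symbols (not_type_fo ps T x) = set ps"
  "free_vars (not_type_fo ps T x) = {x}"
  "fo_size (not_type_fo ps T x) = 2 * length ps + 1"
  by (auto simp: not_type_fo_def big_or_simps elem_type_def sum_list_triv)

text \<open>
  With \<open>z = 0\<close>, \<open>y = 1\<close> and \<open>x\<^sub>j = j + 2\<close>: every element of the type of \<open>z\<close> is one of the \<open>k\<close> witnesses
  \<open>x\<^sub>j\<close>, of which the first \<open>d T\<close> are spoiled if \<open>z\<close> has type \<open>T\<close>. So type \<open>T\<close> has at most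
  \<open>k - d T\<close> elements; since the counts sum to \<open>n\<close>, upper bounds on all of them suffice.
\<close>

definition cover_fo :: "'p list \<Rightarrow> nat \<Rightarrow> 'p fo" where
  "cover_fo ps k = All 1 (big_or (Eq True 1) (differ_fo ps 1 0) [2..<k + 2])"

definition spoil_fo :: "'p list \<Rightarrow> 'p set list \<Rightarrow> ('p set \<Rightarrow> nat) \<Rightarrow> 'p fo" where
  "spoil_fo ps Ts d =
     big_and (\<lambda>T. Or (not_type_fo ps T 0) (big_and (\<lambda>x. differ_fo ps x 0) (Eq True 0 0) [2..<d T + 2]))
       (Eq True 0 0) Ts"

definition counting_fo :: "'p list \<Rightarrow> 'p set list \<Rightarrow> nat \<Rightarrow> ('p set \<Rightarrow> nat) \<Rightarrow> 'p fo" where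
  "counting_fo ps Ts k d = All 0 (foldr Ex [2..<k + 2] (And (cover_fo ps k) (spoil_fo ps Ts d)))"

text \<open>The bound on \<open>d\<close> keeps the spoiled witnesses among the variables of the
  quantifier block.\<close>

lemma counting_fo_sentence:
  assumes "\<And>T. T \<in> set Ts \<Longrightarrow> d T \<le> k"
  shows "counting_fo ps Ts k d \<in> sentences (set ps)"
proof -
  have "free_vars (cover_fo ps k) \<subseteq> insert 0 {2..<k + 2}"
    unfolding cover_fo_def using differ_fo_simps(3)[of ps 1 0] by (auto simp: big_or_simps)
  moreover have "free_vars (spoil_fo ps Ts d) \<subseteq> insert 0 {2..<k + 2}"
  proof -
    have "free_vars (differ_fo ps x 0) \<subseteq> insert 0 {2..<k + 2}" if "T \<in> set Ts" "x \<in> {2..<d T + 2}" for T x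
      using differ_fo_simps(3)[of ps x 0] assms[OF that(1)] that(2) by auto
    then show ?thesis
      unfolding spoil_fo_def big_and_simps free_vars.simps not_type_fo_simps set_upt by blast
  qed
  ultimately have "free_vars (counting_fo ps Ts k d) = {}"
    unfolding counting_fo_def by (auto simp: foldr_Ex_simps)
  moreover have "symbols (counting_fo ps Ts k d) \<subseteq> set ps"
    unfolding counting_fo_def cover_fo_def spoil_fo_def
    by (auto simp: foldr_Ex_simps big_or_simps big_and_simps differ_fo_simps not_type_fo_simps)
  ultimately show ?thesis by (simp add: sentences_def)
qed

text \<open>Beyond the \<open>3 * k\<close> paid for the witnesses, only the term with
  \<open>d T\<close> can grow with the model; it is small when the counts are nearly equal.\<close>

lemma fo_size_counting_fo:
  "fo_size (counting_fo ps Ts k d) =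
     3 * k + 8 * length ps + 5 + (\<Sum>T\<leftarrow>Ts. 2 * length ps + 4 + d T * (8 * length ps + 2))"
proof -
  have Suc4: "Suc (Suc (Suc (Suc m))) = 4 + m" for m by simp
  show ?thesis
    unfolding counting_fo_def cover_fo_def spoil_fo_def
    by (simp add: foldr_Ex_simps big_or_simps big_and_simps differ_fo_simps not_type_fo_simps Suc4
        sum_list_triv algebra_simps del: upt_Suc)
qed

lemma holds_cover_fo:
  "holds n M s (cover_fo ps k) \<longleftrightarrow>
    {b \<in> {1..n}. elem_type (set ps) M b = elem_type (set ps) M (s 0)} \<subseteq> s ` {2..<k + 2}"
  unfolding cover_fo_def by (auto simp: big_or_simps differ_fo_simps simp del: upt_Suc)

lemma holds_spoil_fo:
  assumes "set Ts = Pow (set ps)"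
  shows "holds n M s (spoil_fo ps Ts d) \<longleftrightarrow>
    (\<forall>j\<in>{2..<d (elem_type (set ps) M (s 0)) + 2}.
       elem_type (set ps) M (s j) \<noteq> elem_type (set ps) M (s 0))"
  unfolding spoil_fo_def using elem_type_in_Pow[of "set ps" M "s 0"]
  by (auto simp: big_and_simps differ_fo_simps not_type_fo_simps assms simp del: upt_Suc)

lemma satisfies_counting_fo:
  assumes "set Ts = Pow (set ps)" "\<And>T. T \<in> set Ts \<Longrightarrow> d T \<le> k"
  shows "satisfies n M (counting_fo ps Ts k d) \<longleftrightarrow>
    (\<forall>a\<in>{1..n}. \<exists>f. f ` {2..<k + 2} \<subseteq> {1..n} \<and>
       {b \<in> {1..n}. elem_type (set ps) M b = elem_type (set ps) M a} \<subseteq> f ` {2..<k + 2} \<and>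
       (\<forall>j\<in>{2..<d (elem_type (set ps) M a) + 2}. elem_type (set ps) M (f j) \<noteq> elem_type (set ps) M a))"
proof -
  have "holds n M (override_on (s(0 := a)) f {2..<k + 2}) (And (cover_fo ps k) (spoil_fo ps Ts d)) \<longleftrightarrow>
       {b \<in> {1..n}. elem_type (set ps) M b = elem_type (set ps) M a} \<subseteq> f ` {2..<k + 2} \<and>
       (\<forall>j\<in>{2..<d (elem_type (set ps) M a) + 2}. elem_type (set ps) M (f j) \<noteq> elem_type (set ps) M a)"
    for s a f
  proof -
    let ?s = "override_on (s(0 := a)) f {2..<k + 2}"
    \<comment> \<open>Variable 0 lies outside the block and keeps the value \<open>a\<close>, while
      every index of a spoiled witness lies inside it.\<close>
    have "?s ` {2..<k + 2} = f ` {2..<k + 2}" "?s 0 = a" by (auto simp: override_on_def)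
    moreover have "?s j = f j" if "j \<in> {2..<d (elem_type (set ps) M a) + 2}" for j
      using that assms(2)[of "elem_type (set ps) M a"] elem_type_in_Pow[of "set ps" M a]
      by (auto simp: assms(1) override_on_def)
    ultimately show ?thesis by (simp add: holds_cover_fo holds_spoil_fo[OF assms(1)])
  qed
  then show ?thesis
    unfolding satisfies_def counting_fo_def
    by (simp only: holds.simps(6) holds_foldr_Ex set_upt) blast
qed

text \<open>For the direction from isomorphism to satisfaction, the spoiled witnesses still need
  values outside the type in question. An element of a most frequent type \<open>T0\<close> always
  serves, since no witness is spoiled for \<open>T0\<close> itself.\<close>

lemma counting_fo_defines:
  assumes ps: "set ps = \<tau>" and Ts: "set Ts = Pow \<tau>"
    and k: "\<And>T. T \<in> Pow \<tau> \<Longrightarrow> type_count \<tau> n M T \<le> k"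
    and max: "T0 \<in> Pow \<tau>" "type_count \<tau> n M T0 = k" "0 < k"
  shows "defines_model \<tau> n (counting_fo ps Ts k (\<lambda>T. k - type_count \<tau> n M T)) M"
  unfolding defines_model_def
proof
  fix N assume "N \<in> models \<tau> n"
  let ?d = "\<lambda>T. k - type_count \<tau> n M T"
  let ?A = "\<lambda>T. {b \<in> {1..n}. elem_type \<tau> N b = T}"
  have fin: "finite \<tau>" using ps by auto
  have sat: "satisfies n N (counting_fo ps Ts k ?d) \<longleftrightarrow>
    (\<forall>a\<in>{1..n}. \<exists>f. f ` {2..<k + 2} \<subseteq> {1..n} \<and> ?A (elem_type \<tau> N a) \<subseteq> f ` {2..<k + 2} \<and>
       (\<forall>j\<in>{2..<?d (elem_type \<tau> N a) + 2}. elem_type \<tau> N (f j) \<noteq> elem_type \<tau> N a))"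
    using satisfies_counting_fo[of Ts ps ?d k n N] ps Ts by simp
  show "satisfies n N (counting_fo ps Ts k ?d) \<longleftrightarrow> isomorphic \<tau> n M N"
  proof
    assume "satisfies n N (counting_fo ps Ts k ?d)"
    note sat = this[unfolded sat]
    have le: "type_count \<tau> n N T \<le> type_count \<tau> n M T" if T: "T \<in> Pow \<tau>" for T
    proof (cases "?A T = {}")
      case True
      then show ?thesis by (simp only: type_count_def) simp
    next
      case False
      then obtain a where a: "a \<in> {1..n}" "elem_type \<tau> N a = T" by blast
      obtain f where f: "?A T \<subseteq> f ` {2..<k + 2}" "\<forall>j\<in>{2..<?d T + 2}. elem_type \<tau> N (f j) \<noteq> T"
        using bspec[OF sat a(1)] unfolding a(2) by blast
      \<comment> \<open>Spoiled witnesses cannot cover elements of type \<open>T\<close>, so only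
        \<open>k - ?d T\<close> witnesses remain, which is the count of \<open>T\<close> in
        \<open>M\<close>.\<close>
      have "?A T \<subseteq> f ` {?d T + 2..<k + 2}"
      proof
        fix b assume b: "b \<in> ?A T"
        then obtain j where j: "j \<in> {2..<k + 2}" "b = f j" using f(1) by blast
        with b f(2) have "j \<notin> {2..<?d T + 2}" by blast
        with j show "b \<in> f ` {?d T + 2..<k + 2}" by auto
      qed
      then have "type_count \<tau> n N T \<le> card {?d T + 2..<k + 2}"
        unfolding type_count_def by (rule surj_card_le[rotated]) simp
      also have "\<dots> = type_count \<tau> n M T" using k[OF T] by simp
      finally show ?thesis .
    qed
    \<comment> \<open>Both families of counts sum to \<open>n\<close>, so the termwise inequalities
      are equalities.\<close>
    have "type_count \<tau> n N T = type_count \<tau> n M T" if "T \<in> Pow \<tau>" for T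
      by (rule sum_mono_inv[OF _ le that]) (use fin in \<open>auto simp: sum_type_count\<close>)
    then show "isomorphic \<tau> n M N" by (simp add: isomorphic_iff_type_count_eq)
  next
    assume "isomorphic \<tau> n M N"
    then have eq: "type_count \<tau> n M T = type_count \<tau> n N T" if "T \<in> Pow \<tau>" for T
      using that by (simp add: isomorphic_iff_type_count_eq)
    have "\<exists>f. f ` {2..<k + 2} \<subseteq> {1..n} \<and> ?A (elem_type \<tau> N a) \<subseteq> f ` {2..<k + 2} \<and>
       (\<forall>j\<in>{2..<?d (elem_type \<tau> N a) + 2}. elem_type \<tau> N (f j) \<noteq> elem_type \<tau> N a)"
      if a: "a \<in> {1..n}" for a
    proof -
      define T where "T = elem_type \<tau> N a"
      have T: "T \<in> Pow \<tau>" unfolding T_def by (rule elem_type_in_Pow)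
      have card: "card (?A T) = type_count \<tau> n M T" using eq[OF T] by (simp add: type_count_def)
      have "card {?d T + 2..<k + 2} = card (?A T)" using k[OF T] card by simp
      moreover have "finite (?A T)" by simp
      ultimately obtain g where g: "bij_betw g {?d T + 2..<k + 2} (?A T)"
        using finite_same_card_bij[OF finite_atLeastLessThan] by blast
      have "type_count \<tau> n N T0 = k" using eq[OF max(1)] max(2) by simp
      then have "?A T0 \<noteq> {}" using max(3) unfolding type_count_def by (metis (no_types, lifting) card.empty less_irrefl)
      then obtain w where w: "w \<in> {1..n}" "elem_type \<tau> N w = T0" by blast
      \<comment> \<open>The unspoiled witnesses enumerate type \<open>T\<close>; the spoiled ones
        are all sent to \<open>w\<close>. If there are any, the count of \<open>T\<close> is below
        \<open>k\<close>, so \<open>T\<close> differs from \<open>T0\<close>.\<close>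
      define f where "f j = (if j < ?d T + 2 then w else g j)" for j
      have img: "f ` {?d T + 2..<k + 2} = ?A T"
        using g by (simp add: bij_betw_def f_def)
      have "f ` {2..<k + 2} \<subseteq> {1..n}"
      proof
        fix b assume "b \<in> f ` {2..<k + 2}"
        then obtain j where j: "j \<in> {2..<k + 2}" "b = f j" by blast
        show "b \<in> {1..n}"
        proof (cases "j < ?d T + 2")
          case True
          then show ?thesis using j w by (simp add: f_def)
        next
          case False
          then have "b \<in> ?A T" unfolding img[symmetric] using j by simp
          then show ?thesis by blast
        qed
      qed
      moreover have "?A T \<subseteq> f ` {2..<k + 2}"
        unfolding img[symmetric] by (rule image_mono) auto
      moreover have "elem_type \<tau> N (f j) \<noteq> T" if "j \<in> {2..<?d T + 2}" for j
        using that w max(2) by (auto simp: f_def)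
      ultimately show ?thesis unfolding T_def by blast
    qed
    then show "satisfies n N (counting_fo ps Ts k ?d)" unfolding sat by blast
  qed
qed

lemma exists_defining_sentence:
  assumes "finite \<tau>" "0 < n"
    and "\<And>T. T \<in> Pow \<tau> \<Longrightarrow> type_count \<tau> n M T \<le> k"
    and "T0 \<in> Pow \<tau>" "type_count \<tau> n M T0 = k"
  obtains \<phi> where "\<phi> \<in> sentences \<tau>" "defines_model \<tau> n \<phi> M"
    "fo_size \<phi> = 3 * k + 8 * card \<tau> + 5 +
       (\<Sum>T\<in>Pow \<tau>. 2 * card \<tau> + 4 + (k - type_count \<tau> n M T) * (8 * card \<tau> + 2))"
proof -
  obtain ps where ps: "set ps = \<tau>" "distinct ps" using assms(1) finite_distinct_list by blast
  obtain Ts where Ts: "set Ts = Pow \<tau>" "distinct Ts"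
    using assms(1) finite_distinct_list[of "Pow \<tau>"] by blast
  have len: "length ps = card \<tau>" using ps(1) distinct_card[OF ps(2)] by simp
  have "0 < k"
  proof (rule ccontr)
    assume "\<not> 0 < k"
    then have "(\<Sum>T\<in>Pow \<tau>. type_count \<tau> n M T) = 0" using assms(3) by simp
    then show False using assms(1,2) by (simp add: sum_type_count)
  qed
  let ?\<phi> = "counting_fo ps Ts k (\<lambda>T. k - type_count \<tau> n M T)"
  show ?thesis
  proof (rule that[of ?\<phi>])
    show "?\<phi> \<in> sentences \<tau>" unfolding ps(1)[symmetric] by (rule counting_fo_sentence) simp
    show "defines_model \<tau> n ?\<phi> M"
      using counting_fo_defines[OF ps(1) Ts(1) assms(3-5) \<open>0 < k\<close>] by blast
    show "fo_size ?\<phi> = 3 * k + 8 * card \<tau> + 5 +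
       (\<Sum>T\<in>Pow \<tau>. 2 * card \<tau> + 4 + (k - type_count \<tau> n M T) * (8 * card \<tau> + 2))"
      by (simp only: fo_size_counting_fo len sum_list_distinct_conv_sum_set[OF Ts(2)] Ts(1))
  qed
qed

section \<open>Concentration\<close>

lemma sum_PiE_insert:
  fixes F :: "('a \<Rightarrow> 'b) \<Rightarrow> real"
  assumes "x \<notin> A"
  shows "(\<Sum>f\<in>insert x A \<rightarrow>\<^sub>E B. F f) = (\<Sum>y\<in>B. \<Sum>f\<in>A \<rightarrow>\<^sub>E B. F (f(x := y)))"
  unfolding PiE_insert_eq
  by (subst sum.reindex[OF inj_combinator[OF assms]]) (simp add: sum.cartesian_product case_prod_unfold)

text \<open>Additivity of variance for independent centered variables, with probabilities cleared.
  The factor \<open>card B\<close> on the left avoids the exponent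
  \<open>card A - 1\<close>.\<close>

lemma sum_PiE_square_of_centered_sum:
  fixes g :: "'b \<Rightarrow> real"
  assumes "finite A" "finite B" "(\<Sum>y\<in>B. g y) = 0"
  shows "(\<Sum>f\<in>A \<rightarrow>\<^sub>E B. (\<Sum>a\<in>A. g (f a))\<^sup>2) * card B = card A * card B ^ card A * (\<Sum>y\<in>B. (g y)\<^sup>2)"
  using assms(1)
proof (induction A)
  case empty
  show ?case by simp
next
  case (insert x A)
  let ?S = "\<lambda>f. \<Sum>a\<in>A. g (f a)"
  have card: "card (A \<rightarrow>\<^sub>E B) = card B ^ card A" using insert by (simp add: card_PiE)
  have "(\<Sum>a\<in>insert x A. g ((f(x := y)) a)) = g y + ?S f" for f y
  proof -
    have "(\<Sum>a\<in>A. g ((f(x := y)) a)) = ?S f" using insert by (intro sum.cong) auto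
    then show ?thesis using insert by simp
  qed
  then have "(\<Sum>f\<in>insert x A \<rightarrow>\<^sub>E B. (\<Sum>a\<in>insert x A. g (f a))\<^sup>2)
      = (\<Sum>y\<in>B. \<Sum>f\<in>A \<rightarrow>\<^sub>E B. (g y + ?S f)\<^sup>2)"
    by (simp only: sum_PiE_insert[OF insert.hyps(2)])
  also have "\<dots> = (\<Sum>y\<in>B. card B ^ card A * (g y)\<^sup>2 + g y * (\<Sum>f\<in>A \<rightarrow>\<^sub>E B. 2 * ?S f)
      + (\<Sum>f\<in>A \<rightarrow>\<^sub>E B. (?S f)\<^sup>2))"
    by (intro sum.cong) (simp_all add: power2_sum sum.distrib card sum_distrib_left mult_ac)
  \<comment> \<open>The cross term factors through the sum of \<open>g\<close> over \<open>B\<close>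
    and vanishes.\<close>
  also have "\<dots> = card B ^ card A * (\<Sum>y\<in>B. (g y)\<^sup>2) + card B * (\<Sum>f\<in>A \<rightarrow>\<^sub>E B. (?S f)\<^sup>2)"
    by (simp add: sum.distrib assms(3) flip: sum_distrib_left sum_distrib_right)
  finally show ?case using insert by (simp add: algebra_simps)
qed

section \<open>Random models as independent uniform types\<close>

definition type_profile :: "'p set \<Rightarrow> nat \<Rightarrow> ('p \<Rightarrow> nat set) \<Rightarrow> nat \<Rightarrow> 'p set" where
  "type_profile \<tau> n M = (\<lambda>a\<in>{1..n}. elem_type \<tau> M a)"

text \<open>The inverse reads off each predicate from the types. Averaging over models thus becomes
  averaging over independent uniform choices of a type for each element.\<close>

lemma bij_betw_type_profile: "bij_betw (type_profile \<tau> n) (models \<tau> n) ({1..n} \<rightarrow>\<^sub>E Pow \<tau>)"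
proof (rule bij_betw_byWitness[where f' = "\<lambda>h. \<lambda>p\<in>\<tau>. {a \<in> {1..n}. p \<in> h a}"])
  show "\<forall>M\<in>models \<tau> n. (\<lambda>p\<in>\<tau>. {a \<in> {1..n}. p \<in> type_profile \<tau> n M a}) = M"
  proof
    fix M assume M: "M \<in> models \<tau> n"
    show "(\<lambda>p\<in>\<tau>. {a \<in> {1..n}. p \<in> type_profile \<tau> n M a}) = M"
    proof
      fix p
      show "(\<lambda>p\<in>\<tau>. {a \<in> {1..n}. p \<in> type_profile \<tau> n M a}) p = M p"
      proof (cases "p \<in> \<tau>")
        case True
        then have "M p \<subseteq> {1..n}" using M by (auto simp: models_def)
        then show ?thesis using True by (auto simp: type_profile_def elem_type_def)
      next
        case False
        then show ?thesis using M by (auto simp: models_def PiE_def extensional_def)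
      qed
    qed
  qed
  show "\<forall>h\<in>{1..n} \<rightarrow>\<^sub>E Pow \<tau>. type_profile \<tau> n (\<lambda>p\<in>\<tau>. {a \<in> {1..n}. p \<in> h a}) = h"
  proof
    fix h assume h: "h \<in> {1..n} \<rightarrow>\<^sub>E Pow \<tau>"
    show "type_profile \<tau> n (\<lambda>p\<in>\<tau>. {a \<in> {1..n}. p \<in> h a}) = h"
    proof
      fix a
      show "type_profile \<tau> n (\<lambda>p\<in>\<tau>. {a \<in> {1..n}. p \<in> h a}) a = h a"
      proof (cases "a \<in> {1..n}")
        case True
        then have "h a \<subseteq> \<tau>" using h by auto
        then show ?thesis using True by (auto simp: type_profile_def elem_type_def)
      next
        case False
        then show ?thesis using h by (auto simp: type_profile_def PiE_def extensional_def)
      qed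
    qed
  qed
qed (auto simp: type_profile_def models_def elem_type_def)

lemma card_models:
  assumes "finite \<tau>"
  shows "card (models \<tau> n) = 2 ^ (card \<tau> * n)"
  using bij_betw_same_card[OF bij_betw_type_profile[of \<tau> n]] assms
  by (simp add: card_PiE card_Pow power_mult)

definition deviation :: "'p set \<Rightarrow> nat \<Rightarrow> ('p \<Rightarrow> nat set) \<Rightarrow> 'p set \<Rightarrow> real" where
  "deviation \<tau> n M T = \<bar>type_count \<tau> n M T - n / 2 ^ card \<tau>\<bar>"

text \<open>The deviation is the absolute value of a sum of \<open>n\<close> centered indicators
  \<open>g\<close>, one for each element, so the second moment formula applies.\<close>

lemma sum_models_deviation_square:
  assumes "finite \<tau>" "T \<in> Pow \<tau>"
  shows "(\<Sum>M\<in>models \<tau> n. (deviation \<tau> n M T)\<^sup>2) \<le> n * 2 ^ (card \<tau> * n)"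
proof -
  define t :: real where "t = 2 ^ card \<tau>"
  have t: "t \<ge> 1" by (simp add: t_def)
  define g where "g S = of_bool (S = T) - 1 / t" for S
  have card: "real (card (Pow \<tau>)) = t" using assms(1) by (simp add: card_Pow t_def)
  have fin: "finite (Pow \<tau>)" using assms(1) by simp
  have "(\<Sum>S\<in>Pow \<tau>. of_bool (S = T)) = (1::real)" using assms fin by (simp add: of_bool_def)
  then have g0: "(\<Sum>S\<in>Pow \<tau>. g S) = 0" using t by (simp add: g_def sum_subtractf card)
  have dev: "deviation \<tau> n M T = \<bar>\<Sum>a\<in>{1..n}. g (type_profile \<tau> n M a)\<bar>" for M
  proof -
    have "(\<Sum>a\<in>{1..n}. of_bool (elem_type \<tau> M a = T)) = real (type_count \<tau> n M T)"
      by (simp add: of_bool_def type_count_def sum.If_cases Int_def)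
    then show ?thesis by (simp add: deviation_def g_def type_profile_def sum_subtractf t_def)
  qed
  have "(\<Sum>M\<in>models \<tau> n. (deviation \<tau> n M T)\<^sup>2) = (\<Sum>f\<in>{1..n} \<rightarrow>\<^sub>E Pow \<tau>. (\<Sum>a\<in>{1..n}. g (f a))\<^sup>2)"
    unfolding dev power2_abs by (rule sum.reindex_bij_betw[OF bij_betw_type_profile])
  then have "(\<Sum>M\<in>models \<tau> n. (deviation \<tau> n M T)\<^sup>2) * t = n * t ^ n * (\<Sum>S\<in>Pow \<tau>. (g S)\<^sup>2)"
    using sum_PiE_square_of_centered_sum[OF _ fin g0, of "{1..n}"] card by simp
  \<comment> \<open>The crude bound 1 on each squared value already gives the order
    \<open>sqrt n\<close>.\<close>
  also have "\<dots> \<le> n * t ^ n * (\<Sum>S\<in>Pow \<tau>. 1)"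
  proof (intro mult_left_mono sum_mono)
    show "(g S)\<^sup>2 \<le> 1" for S
      using t by (simp add: g_def abs_square_le_1 field_simps)
  qed (use t in auto)
  also have "\<dots> = n * t ^ n * t" using card by simp
  finally have "(\<Sum>M\<in>models \<tau> n. (deviation \<tau> n M T)\<^sup>2) \<le> n * t ^ n" using t by simp
  then show ?thesis by (simp add: t_def power_mult)
qed

text \<open>Passage from second to first moment: \<open>2 * sqrt n * x \<le> n + x\<^sup>2\<close>
  is summed over all models, and both terms on the right contribute at most \<open>n\<close> on
  average.\<close>

lemma average_deviation_le:
  assumes "finite \<tau>" "T \<in> Pow \<tau>" "0 < n"
  shows "(\<Sum>M\<in>models \<tau> n. deviation \<tau> n M T) \<le> sqrt n * 2 ^ (card \<tau> * n)"
proof -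
  have "2 * sqrt n * (\<Sum>M\<in>models \<tau> n. deviation \<tau> n M T)
      = (\<Sum>M\<in>models \<tau> n. 2 * sqrt n * deviation \<tau> n M T)"
    by (simp add: sum_distrib_left)
  also have "\<dots> \<le> (\<Sum>M\<in>models \<tau> n. n + (deviation \<tau> n M T)\<^sup>2)"
    by (intro sum_mono) (use sum_squares_bound[of "sqrt n"] in auto)
  also have "\<dots> = n * 2 ^ (card \<tau> * n) + (\<Sum>M\<in>models \<tau> n. (deviation \<tau> n M T)\<^sup>2)"
    using assms(1) by (simp add: sum.distrib card_models)
  also have "\<dots> \<le> 2 * n * 2 ^ (card \<tau> * n)"
    using sum_models_deviation_square[OF assms(1,2), of n] by simp
  also have "\<dots> = 2 * sqrt n * (sqrt n * 2 ^ (card \<tau> * n))" by simp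
  finally show ?thesis using assms(3) by simp
qed

section \<open>The expected description complexity\<close>

lemma description_complexity_witness:
  assumes "\<phi> \<in> sentences \<tau>" "defines_model \<tau> n \<phi> M"
  obtains \<psi> where "\<psi> \<in> sentences \<tau>" "defines_model \<tau> n \<psi> M"
    "fo_size \<psi> = description_complexity \<tau> n M" "description_complexity \<tau> n M \<le> fo_size \<phi>"
proof -
  let ?P = "\<lambda>k. \<exists>\<phi>\<in>sentences \<tau>. defines_model \<tau> n \<phi> M \<and> fo_size \<phi> = k"
  have P: "?P (fo_size \<phi>)" using assms by blast
  show ?thesis
    using LeastI[of ?P, OF P] Least_le[of ?P, OF P] that unfolding description_complexity_def by blast
qed

text \<open>The largest count \<open>k\<close> governs the upper bound and the smallest count
  \<open>m\<close> the lower one; both lie within the total deviation of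
  \<open>n / 2 ^ card \<tau>\<close>. The constant depends on the vocabulary only.\<close>

lemma description_complexity_approx:
  fixes \<tau> :: "'p set"
  assumes "finite \<tau>" "\<tau> \<noteq> {}"
  obtains K :: real where "0 \<le> K" and
    "\<And>n M. 0 < n \<Longrightarrow> M \<in> models \<tau> n \<Longrightarrow>
      \<bar>description_complexity \<tau> n M - 3 * real n / 2 ^ card \<tau>\<bar> \<le> K * ((\<Sum>T\<in>Pow \<tau>. deviation \<tau> n M T) + 1)"
proof -
  define c where "c = real (card \<tau>)"
  define t :: real where "t = 2 ^ card \<tau>"
  \<comment> \<open>Chosen to dominate the constant term and the coefficient of \<open>D\<close> in
    the upper estimate, as well as the 3 of the lower estimate.\<close>
  define K where "K = 8 * c + 8 + t * (2 * c + 4) + t * (2 * (8 * c + 2))"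
  have c: "0 \<le> c" by (simp add: c_def)
  have t: "1 \<le> t" by (simp add: t_def)
  have K: "3 \<le> K" using c t by (simp add: K_def)
  have card: "real (card (Pow \<tau>)) = t" using assms(1) by (simp add: card_Pow t_def)
  have "\<bar>description_complexity \<tau> n M - 3 * real n / t\<bar> \<le> K * ((\<Sum>T\<in>Pow \<tau>. deviation \<tau> n M T) + 1)"
    if n: "0 < n" and M: "M \<in> models \<tau> n" for n M
  proof -
    let ?C = "type_count \<tau> n M"
    define D where "D = (\<Sum>T\<in>Pow \<tau>. deviation \<tau> n M T)"
    have dev: "\<bar>?C T - n / t\<bar> \<le> D" if "T \<in> Pow \<tau>" for T
      using member_le_sum[OF that, of "deviation \<tau> n M"] assms(1)
      by (simp add: D_def deviation_def t_def)
    have D: "0 \<le> D" by (simp add: D_def deviation_def sum_nonneg)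
    have fin: "finite (?C ` Pow \<tau>)" "?C ` Pow \<tau> \<noteq> {}" using assms(1) by auto
    define k where "k = Max (?C ` Pow \<tau>)"
    define m where "m = Min (?C ` Pow \<tau>)"
    obtain T0 where T0: "T0 \<in> Pow \<tau>" "?C T0 = k" using Max_in[OF fin] by (auto simp: k_def)
    obtain T1 where T1: "T1 \<in> Pow \<tau>" "?C T1 = m" using Min_in[OF fin] by (auto simp: m_def)
    have le_k: "?C T \<le> k" if "T \<in> Pow \<tau>" for T using that fin by (simp add: k_def)
    have ge_m: "m \<le> ?C T" if "T \<in> Pow \<tau>" for T using that fin by (simp add: m_def)
    obtain \<phi> where \<phi>: "\<phi> \<in> sentences \<tau>" "defines_model \<tau> n \<phi> M"
      "fo_size \<phi> = 3 * k + 8 * card \<tau> + 5 +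
         (\<Sum>T\<in>Pow \<tau>. 2 * card \<tau> + 4 + (k - ?C T) * (8 * card \<tau> + 2))"
      using exists_defining_sentence[OF assms(1) n le_k T0] by blast
    obtain \<psi> where \<psi>: "\<psi> \<in> sentences \<tau>" "defines_model \<tau> n \<psi> M"
      "fo_size \<psi> = description_complexity \<tau> n M" "description_complexity \<tau> n M \<le> fo_size \<phi>"
      using description_complexity_witness[OF \<phi>(1,2)] by blast
    have "real (description_complexity \<tau> n M) \<le> fo_size \<phi>" using \<psi>(4) by simp
    also have "\<dots> = 3 * real k + 8 * c + 5 + (\<Sum>T\<in>Pow \<tau>. 2 * c + 4 + real (k - ?C T) * (8 * c + 2))"
      by (simp only: \<phi>(3) c_def of_nat_add of_nat_mult of_nat_sum of_nat_numeral)
    also have "\<dots> \<le> 3 * (n / t + D) + 8 * c + 5 + (\<Sum>T\<in>Pow \<tau>. 2 * c + 4 + 2 * D * (8 * c + 2))"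
    proof (intro add_mono sum_mono mult_left_mono mult_right_mono order_refl)
      show "real k \<le> n / t + D" using dev[OF T0(1)] T0(2) by (simp add: abs_le_iff)
      \<comment> \<open>Both \<open>k\<close> and the count of \<open>T\<close> are within
        \<open>D\<close> of \<open>n / t\<close>.\<close>
      show "real (k - ?C T) \<le> 2 * D" if "T \<in> Pow \<tau>" for T
        using dev[OF that] dev[OF T0(1)] le_k[OF that] T0(2) by (simp add: of_nat_diff abs_le_iff)
    qed (use c in auto)
    also have "\<dots> = 3 * real n / t + (8 * c + 5 + t * (2 * c + 4)) + (3 + t * (2 * (8 * c + 2))) * D"
      using card by (simp add: algebra_simps)
    also have "\<dots> \<le> 3 * real n / t + K + K * D"
      using c t D by (intro add_mono mult_right_mono) (simp_all add: K_def)
    finally have upper: "description_complexity \<tau> n M \<le> 3 * real n / t + K * (D + 1)"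
      by (simp add: algebra_simps)
    \<comment> \<open>One element is given up to the nearby model, hence \<open>m - 1\<close>; for
      \<open>m = 0\<close> truncated subtraction makes the claim trivial.\<close>
    have "3 * (m - 1) \<le> description_complexity \<tau> n M"
    proof (cases "m = 0")
      case False
      then show ?thesis
        using fo_size_ge_if_defines[OF assms M _ \<psi>(1,2), of "m - 1"] ge_m \<psi>(3) by auto
    qed simp
    then have "3 * m \<le> description_complexity \<tau> n M + 3" by arith
    then have "real (3 * m) \<le> real (description_complexity \<tau> n M + 3)" by (simp only: of_nat_le_iff)
    then have "3 * (real m - 1) \<le> description_complexity \<tau> n M" by simp
    moreover have "n / t - D \<le> m" using dev[OF T1(1)] T1(2) by (simp add: abs_le_iff)
    moreover have "3 * (D + 1) \<le> K * (D + 1)" using K D by (intro mult_right_mono) auto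
    ultimately show ?thesis using upper by (simp add: D_def abs_le_iff)
  qed
  then show ?thesis using that[of K] K by (simp add: t_def)
qed

lemma expected_complexity_approx:
  fixes \<tau> :: "'p set"
  assumes "finite \<tau>" "\<tau> \<noteq> {}"
  obtains K :: real where
    "\<And>n. 0 < n \<Longrightarrow> \<bar>expected_complexity \<tau> n - 3 * real n / 2 ^ card \<tau>\<bar> \<le> K * (2 ^ card \<tau> * sqrt n + 1)"
proof -
  obtain K :: real where K: "0 \<le> K" "\<And>n M. 0 < n \<Longrightarrow> M \<in> models \<tau> n \<Longrightarrow>
      \<bar>description_complexity \<tau> n M - 3 * real n / 2 ^ card \<tau>\<bar> \<le> K * ((\<Sum>T\<in>Pow \<tau>. deviation \<tau> n M T) + 1)"
    using description_complexity_approx[OF assms] by blast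
  have "\<bar>expected_complexity \<tau> n - 3 * real n / 2 ^ card \<tau>\<bar> \<le> K * (2 ^ card \<tau> * sqrt n + 1)" if n: "0 < n" for n
  proof -
    define N :: real where "N = 2 ^ (card \<tau> * n)"
    define b where "b = 3 * real n / 2 ^ card \<tau>"
    have N: "0 < N" and card: "real (card (models \<tau> n)) = N"
      using assms(1) by (simp_all add: N_def card_models)
    have "\<bar>\<Sum>M\<in>models \<tau> n. description_complexity \<tau> n M - b\<bar>
        \<le> (\<Sum>M\<in>models \<tau> n. K * ((\<Sum>T\<in>Pow \<tau>. deviation \<tau> n M T) + 1))"
      unfolding b_def by (rule order_trans[OF sum_abs sum_mono]) (rule K(2)[OF n])
    \<comment> \<open>Exchanging the sums reduces the average total deviation to one average for
      each type.\<close>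
    also have "\<dots> = K * ((\<Sum>T\<in>Pow \<tau>. \<Sum>M\<in>models \<tau> n. deviation \<tau> n M T) + N)"
      by (subst sum.swap) (simp add: sum.distrib card flip: sum_distrib_left)
    also have "\<dots> \<le> K * ((\<Sum>T\<in>Pow \<tau>. sqrt n * N) + N)"
      unfolding N_def using assms(1) n K(1)
      by (intro mult_left_mono add_mono sum_mono average_deviation_le) auto
    also have "\<dots> = K * (2 ^ card \<tau> * sqrt n + 1) * N"
      using assms(1) by (simp add: card_Pow algebra_simps)
    finally have "\<bar>(\<Sum>M\<in>models \<tau> n. real (description_complexity \<tau> n M)) - N * b\<bar>
        \<le> K * (2 ^ card \<tau> * sqrt n + 1) * N"
      by (simp add: sum_subtractf card)
    moreover have "expected_complexity \<tau> n - b
        = ((\<Sum>M\<in>models \<tau> n. real (description_complexity \<tau> n M)) - N * b) / N"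
      unfolding expected_complexity_def N_def[symmetric] using N by (simp add: field_simps)
    ultimately show ?thesis using N by (simp add: b_def[symmetric] abs_divide pos_divide_le_eq)
  qed
  then show ?thesis by (rule that)
qed

theorem theorem5:
  fixes \<tau> :: "'p set"
  assumes "finite \<tau>" and "\<tau> \<noteq> {}"
  shows "expected_complexity \<tau> \<sim>[at_top] (\<lambda>n. 3 * real n / 2 ^ card \<tau>)"
proof (rule asymp_equivI')
  define t :: real where "t = 2 ^ card \<tau>"
  have t: "0 < t" by (simp add: t_def)
  obtain K :: real where
    K: "\<And>n. 0 < n \<Longrightarrow> \<bar>expected_complexity \<tau> n - 3 * real n / t\<bar> \<le> K * (t * sqrt n + 1)"
    using expected_complexity_approx[OF assms] unfolding t_def by blast
  \<comment> \<open>The absolute error is of order \<open>sqrt n\<close> against a main term linear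
    in \<open>n\<close>, so the relative error is of order \<open>1 / sqrt n\<close>.\<close>
  have "(\<lambda>n. expected_complexity \<tau> n / (3 * real n / t) - 1) \<longlonglongrightarrow> 0"
  proof (rule tendsto_0_le)
    show "\<forall>\<^sub>F n in sequentially. norm (expected_complexity \<tau> n / (3 * real n / t) - 1)
        \<le> norm (K * (t * sqrt n + 1) / (3 * real n / t)) * 1"
      using eventually_gt_at_top[of 0]
    proof eventually_elim
      case (elim n)
      then have pos: "0 < 3 * real n / t" using t by simp
      then have "expected_complexity \<tau> n / (3 * real n / t) - 1
          = (expected_complexity \<tau> n - 3 * real n / t) / (3 * real n / t)"
        by (simp only: diff_divide_distrib divide_self[OF less_imp_neq[symmetric]])
      then have "norm (expected_complexity \<tau> n / (3 * real n / t) - 1)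
          \<le> K * (t * sqrt n + 1) / (3 * real n / t)"
        unfolding real_norm_def using divide_right_mono[OF K[OF elim], of "3 * real n / t"] pos
        by (simp only: abs_div_pos[OF pos, symmetric] less_imp_le)
      also have "\<dots> \<le> norm (K * (t * sqrt n + 1) / (3 * real n / t)) * 1"
        by (simp only: real_norm_def mult_1_right abs_ge_self)
      finally show ?case .
    qed
    show "(\<lambda>n. K * (t * sqrt (real n) + 1) / (3 * real n / t)) \<longlonglongrightarrow> 0"
      using t by real_asymp
  qed
  then show "(\<lambda>n. expected_complexity \<tau> n / (3 * real n / 2 ^ card \<tau>)) \<longlonglongrightarrow> 1"
    unfolding t_def by (simp add: LIM_zero_iff)
qed

end
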